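(* Let $A$ be an arbitrary deterministic and stateless load-balancing algorithm. For every even $n$, there exist a $d$-regular graph on $n$ nodes and an initial load distribution such that $A$ cannot achieve discrepancy better than $c\,d$ (i.e., at every time step the discrepancy is at least $c\,d$), for some positive constant $c>0$.
   Context: Model: on a $d$-regular graph (viewed as symmetric directed), each node $u$ holds $x_t(u)$ indivisible tokens at the beginning of synchronous step $t$; in each step, each node sends some number of tokens along each of its incident edges and keeps the rest (possibly via self-loops/a remainder), and its new load is the number of tokens it kept plus the number received. The discrepancy is $\max_u x_t(u)-\min_u x_t(u)$. An algorithm is deterministic and stateless if, in every step, the numbers of tokens that a node sends along its edges and keeps are determined solely by the node's current load (the assignment of these numbers to particular incident edges being given by the node's local edge labeling, which is not controlled by the algorithm). *)

theory Defs
  imports Complex_Main "Graph_Theory.Digraph"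
begin

text \<open>
  A deterministic stateless algorithm \<open>A\<close>: on a \<open>d\<close>-regular graph, a node of current load \<open>x\<close>
  sends \<open>A d x p\<close> tokens along its incident edge with local label \<open>p < d\<close> and keeps the rest.
  Which edge carries which label is not part of the algorithm.
\<close>

type_synonym stateless_alg = "nat \<Rightarrow> nat \<Rightarrow> nat \<Rightarrow> nat"

definition sent :: "stateless_alg \<Rightarrow> nat \<Rightarrow> nat \<Rightarrow> nat" where
  "sent A d x = (\<Sum>p<d. A d x p)"

definition kept :: "stateless_alg \<Rightarrow> nat \<Rightarrow> nat \<Rightarrow> nat" where
  "kept A d x = x - sent A d x"

definition valid_alg :: "stateless_alg \<Rightarrow> bool" where
  "valid_alg A \<longleftrightarrow> (\<forall>d x. sent A d x \<le> x)"

definition regular :: "('v, 'e) pre_digraph \<Rightarrow> nat \<Rightarrow> bool" where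
  "regular G d \<longleftrightarrow> (\<forall>u \<in> verts G. out_degree G u = d)"

text \<open>
  Each undirected edge is a pair of opposite arcs; the label of an arc is the label that its
  tail gives to the edge, so the two ends of an edge label it independently.
\<close>

definition edge_labeling :: "('v, 'e) pre_digraph \<Rightarrow> nat \<Rightarrow> ('e \<Rightarrow> nat) \<Rightarrow> bool" where
  "edge_labeling G d L \<longleftrightarrow> (\<forall>u \<in> verts G. bij_betw L (out_arcs G u) {..<d})"

definition balance_step ::
  "stateless_alg \<Rightarrow> nat \<Rightarrow> ('v, 'e) pre_digraph \<Rightarrow> ('e \<Rightarrow> nat) \<Rightarrow> ('v \<Rightarrow> nat) \<Rightarrow> 'v \<Rightarrow> nat" where
  "balance_step A d G L x u =
     kept A d (x u) + (\<Sum>a \<in> in_arcs G u. A d (x (tail G a)) (L a))"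

primrec load_at ::
  "stateless_alg \<Rightarrow> nat \<Rightarrow> ('v, 'e) pre_digraph \<Rightarrow> ('e \<Rightarrow> nat) \<Rightarrow> ('v \<Rightarrow> nat) \<Rightarrow> nat \<Rightarrow> 'v \<Rightarrow> nat" where
  "load_at A d G L x\<^sub>0 0 = x\<^sub>0"
| "load_at A d G L x\<^sub>0 (Suc t) = balance_step A d G L (load_at A d G L x\<^sub>0 t)"

definition discrepancy :: "('v, 'e) pre_digraph \<Rightarrow> ('v \<Rightarrow> nat) \<Rightarrow> nat" where
  "discrepancy G x = Max (x ` verts G) - Min (x ` verts G)"

end

theory Submission
  imports Defs
begin

text \<open>
  For \<open>d \<ge> 2\<close> put \<open>h = d div 2\<close> and take a circulant \<open>d\<close>-regular graph in which the \<open>h + 1\<close>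
  consecutive vertices \<open>0, \<dots>, h\<close> form a clique. Give load \<open>h\<close> to the clique and load \<open>0\<close> to all
  other vertices. A vertex of load \<open>h\<close> uses at most \<open>h\<close> ports, so the labeling can direct all its
  tokens to its \<open>h\<close> neighbours in the clique; if the ports are assigned cyclically, each clique
  vertex receives exactly what it sends, and the configuration is stationary with discrepancy \<open>h\<close>.
  For \<open>d = 1\<close> a single token suffices: the total load \<open>1\<close> is conserved and is not divisible by \<open>n\<close>.
\<close>

section \<open>Cyclic offsets\<close>

text \<open>
  For distinct \<open>u, v \<le> h\<close>, this is one less than the residue of \<open>v - u\<close> modulo \<open>h + 1\<close>.
\<close>

definition cyclic_offset :: "nat \<Rightarrow> nat \<Rightarrow> nat \<Rightarrow> nat" where
  "cyclic_offset h u v = (if u < v then v - u - 1 else v + h - u)"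

lemma bij_betw_cyclic_offset_head:
  assumes "u \<le> h"
  shows "bij_betw (cyclic_offset h u) ({..h} - {u}) {..<h}"
  \<comment> \<open>The inverse is \<open>u + q + 1\<close> reduced modulo \<open>h + 1\<close>; on
    wrap-around, subtracting \<open>h + 1\<close> leaves \<open>u + q - h\<close>.\<close>
  by (rule bij_betw_byWitness[where f' = "\<lambda>q. if u + q + 1 \<le> h then u + q + 1 else u + q - h"])
    (use assms in \<open>auto simp: cyclic_offset_def\<close>)

text \<open>The offset also runs through each value once when the head is fixed. This is what later
  matches the tokens a clique vertex receives with those it sends.\<close>

lemma bij_betw_cyclic_offset_tail:
  assumes "u \<le> h"
  shows "bij_betw (\<lambda>w. cyclic_offset h w u) ({..h} - {u}) {..<h}"
  by (rule bij_betw_byWitness[where f' = "\<lambda>q. if q + 1 \<le> u then u - q - 1 else u + h - q"])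
    (use assms in \<open>auto simp: cyclic_offset_def\<close>)

text \<open>The residues of \<open>v - u\<close> and \<open>u - v\<close> add up to
  \<open>h + 1\<close>, and each offset is one less than its residue.\<close>

lemma cyclic_offset_swap:
  assumes "u \<le> h" "v \<le> h" "u \<noteq> v"
  shows "cyclic_offset h v u = h - 1 - cyclic_offset h u v"
  using assms by (auto simp: cyclic_offset_def)

section \<open>Circulant graphs\<close>

text \<open>A Cayley graph of the integers modulo \<open>N + 1\<close>: an element \<open>t\<close>
  of \<open>T\<close> stands for the connection residue \<open>t + 1\<close>.\<close>

definition circulant :: "nat \<Rightarrow> nat set \<Rightarrow> (nat, nat \<times> nat) pre_digraph" where
  "circulant N T = \<lparr>verts = {..N},
     arcs = {(u, v). u \<le> N \<and> v \<le> N \<and> u \<noteq> v \<and> cyclic_offset N u v \<in> T},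
     tail = fst, head = snd\<rparr>"

lemma circulant_simps [simp]:
  "verts (circulant N T) = {..N}"
  "tail (circulant N T) = fst"
  "head (circulant N T) = snd"
  "(u, v) \<in> arcs (circulant N T) \<longleftrightarrow> u \<le> N \<and> v \<le> N \<and> u \<noteq> v \<and> cyclic_offset N u v \<in> T"
  by (auto simp: circulant_def)

lemma finite_arcs_circulant: "finite (arcs (circulant N T))"
  by (rule finite_subset[of _ "{..N} \<times> {..N}"]) (auto simp: circulant_def)

text \<open>By \<open>cyclic_offset_swap\<close>, the assumption says that the connection set is
  closed under negation.\<close>

lemma graph_circulant:
  assumes "\<And>t. t \<in> T \<Longrightarrow> N - 1 - t \<in> T"
  shows "graph (circulant N T)"
proof -
  have "digraph (circulant N T)"
    by unfold_locales (auto simp: finite_arcs_circulant arc_to_ends_def)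
  moreover have "sym_digraph (circulant N T)"
  proof -
    interpret digraph "circulant N T" by fact
    have "arcs_ends (circulant N T) = arcs (circulant N T)"
      by (auto simp: arcs_ends_def arc_to_ends_def)
    moreover have "sym (arcs (circulant N T))"
    proof (rule symI)
      fix u v assume "(u, v) \<in> arcs (circulant N T)"
      then have uv: "u \<le> N" "v \<le> N" "u \<noteq> v" "cyclic_offset N u v \<in> T"
        by simp_all
      then have "cyclic_offset N v u \<in> T"
        using assms[OF uv(4)] cyclic_offset_swap[OF uv(1-3)] by simp
      then show "(v, u) \<in> arcs (circulant N T)"
        using uv by simp
    qed
    ultimately show ?thesis
      by unfold_locales (simp add: symmetric_def)
  qed
  ultimately show ?thesis
    by (simp add: graph_def pseudo_graph_def digraph_def)
qed

text \<open>The offset maps the out-neighbours of any vertex bijectively onto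
  \<open>T\<close>.\<close>

lemma regular_circulant:
  assumes "T \<subseteq> {..<N}"
  shows "regular (circulant N T) (card T)"
  unfolding regular_def
proof
  fix u assume "u \<in> verts (circulant N T)"
  then have u: "u \<le> N" by simp
  let ?V = "({..N} - {u}) \<inter> cyclic_offset N u -` T"
  have "bij_betw (cyclic_offset N u) ?V T"
  proof (rule bij_betw_subset[OF bij_betw_cyclic_offset_head[OF u]])
    have "cyclic_offset N u ` ?V = cyclic_offset N u ` ({..N} - {u}) \<inter> T"
      by blast
    also have "cyclic_offset N u ` ({..N} - {u}) = {..<N}"
      using bij_betw_cyclic_offset_head[OF u] by (rule bij_betw_imp_surj_on)
    finally show "cyclic_offset N u ` ?V = T"
      using assms by (simp add: inf.absorb2)
  qed simp
  then have "card ?V = card T"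
    by (rule bij_betw_same_card)
  moreover have "out_arcs (circulant N T) u = Pair u ` ?V"
    using u by (auto simp: out_arcs_def)
  ultimately show "out_degree (circulant N T) u = card T"
    by (simp add: out_degree_def card_image inj_on_def)
qed

text \<open>
  The residues \<open>\<plusminus>1, \<dots>, \<plusminus>h\<close> modulo \<open>N + 1\<close> with \<open>h = d div 2\<close>, and the antipode
  \<open>(N + 1) / 2\<close> if \<open>d\<close> is odd, each decreased by one as in \<open>cyclic_offset\<close>.
\<close>

definition band_offsets :: "nat \<Rightarrow> nat \<Rightarrow> nat set" where
  "band_offsets N d = {..<d div 2} \<union> {N - d div 2..<N} \<union> (if odd d then {N div 2} else {})"

text \<open>With \<open>N = 2 * m + 1\<close>, the antipode has offset \<open>m\<close>, which is
  its own mirror image. Since \<open>h \<le> m\<close>, the two bands are disjoint and leave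
  \<open>m\<close> free.\<close>

lemma
  assumes "odd N" "d \<le> N"
  shows band_offsets_subset: "band_offsets N d \<subseteq> {..<N}"
    and card_band_offsets: "card (band_offsets N d) = d"
    and band_offsets_sym: "t \<in> band_offsets N d \<Longrightarrow> N - 1 - t \<in> band_offsets N d"
proof -
  obtain m where N: "N = 2 * m + 1" using \<open>odd N\<close> by (elim oddE)
  define h where "h = d div 2"
  have h: "h \<le> m" "odd d \<Longrightarrow> h + h + 1 = d" "even d \<Longrightarrow> h + h = d"
    using assms(2) N unfolding h_def by presburger+
  show "band_offsets N d \<subseteq> {..<N}"
    using N h by (auto simp: band_offsets_def h_def[symmetric])
  show "N - 1 - t \<in> band_offsets N d" if "t \<in> band_offsets N d"
    using N h that by (auto simp: band_offsets_def h_def[symmetric] split: if_splits)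
  have "card ({..<h} \<union> {N - h..<N}) = 2 * h"
    using N h by (subst card_Un_disjoint) auto
  moreover have "m \<notin> {..<h} \<union> {N - h..<N}"
    using N h by auto
  ultimately show "card (band_offsets N d) = d"
    using N h by (auto simp: band_offsets_def h_def[symmetric])
qed

text \<open>The two vertices differ by at most \<open>d div 2\<close>, so the offset falls in the
  lower band if \<open>u < v\<close> and in the upper band otherwise.\<close>

lemma clique_circulant_band:
  assumes "d \<le> N" "u \<le> d div 2" "v \<le> d div 2" "u \<noteq> v"
  shows "(u, v) \<in> arcs (circulant N (band_offsets N d))"
proof -
  have N: "u \<le> N" "v \<le> N"
    using assms(1-3) by linarith+
  have "cyclic_offset N u v \<in> {..<d div 2} \<union> {N - d div 2..<N}"
  proof (cases "u < v")
    case True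
    then have "cyclic_offset N u v < d div 2"
      using assms(3) by (simp add: cyclic_offset_def)
    then show ?thesis
      by simp
  next
    case False
    then have "v < u" "cyclic_offset N u v = v + N - u"
      using assms(4) by (simp_all add: cyclic_offset_def)
    then have "N - d div 2 \<le> cyclic_offset N u v" "cyclic_offset N u v < N"
      using assms(2) N by linarith+
    then show ?thesis
      by simp
  qed
  then show ?thesis
    using N assms(4) by (simp add: band_offsets_def)
qed

section \<open>Edge labelings\<close>

text \<open>A label belongs to the tail of its arc alone, so bijections chosen separately at the
  vertices never conflict.\<close>

lemma edge_labeling_choice:
  assumes "\<And>u. u \<in> verts G \<Longrightarrow>
    \<exists>f. bij_betw f (out_arcs G u) {..<d} \<and> (\<forall>a \<in> out_arcs G u. Q a (f a))"
  obtains L where "edge_labeling G d L"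
    and "\<And>a. a \<in> arcs G \<Longrightarrow> tail G a \<in> verts G \<Longrightarrow> Q a (L a)"
proof -
  obtain F where F: "\<And>u. u \<in> verts G \<Longrightarrow> bij_betw (F u) (out_arcs G u) {..<d}"
    "\<And>u a. u \<in> verts G \<Longrightarrow> a \<in> out_arcs G u \<Longrightarrow> Q a (F u a)"
    using assms by metis
  define L where "L a = F (tail G a) a" for a
  have "bij_betw L (out_arcs G u) {..<d}" if "u \<in> verts G" for u
    using F(1)[OF that] by (rule bij_betw_cong[THEN iffD1, rotated]) (simp add: L_def)
  then have "edge_labeling G d L"
    by (simp add: edge_labeling_def)
  moreover have "Q a (L a)" if "a \<in> arcs G" "tail G a \<in> verts G" for a
    using F(2)[of "tail G a" a] that by (simp add: L_def out_arcs_def)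
  ultimately show thesis by (rule that)
qed

lemma regular_imp_ex_edge_labeling:
  assumes "finite (arcs G)" "regular G d"
  obtains L where "edge_labeling G d L"
proof -
  have "finite (out_arcs G u)" for u
    using assms(1) by (simp add: out_arcs_def)
  then have "\<exists>f. bij_betw f (out_arcs G u) {..<d} \<and> (\<forall>a \<in> out_arcs G u. True)"
    if "u \<in> verts G" for u
    using assms(2) that by (auto simp: regular_def out_degree_def intro!: finite_same_card_bij)
  then show thesis
    using edge_labeling_choice[of G d "\<lambda>_ _. True"] that by blast
qed

section \<open>Conservation of the total load\<close>

text \<open>Double counting: grouped by head, the arcs carry what is received; grouped by tail, what
  is sent.\<close>

lemma sum_balance_step:
  assumes "valid_alg A" "edge_labeling G d L" and "fin_digraph G"
  shows "(\<Sum>u \<in> verts G. balance_step A d G L x u) = (\<Sum>u \<in> verts G. x u)"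
proof -
  have G: "finite (verts G)" "finite (arcs G)"
    "tail G ` arcs G \<subseteq> verts G" "head G ` arcs G \<subseteq> verts G"
    using assms(3) by (auto simp: fin_digraph_def fin_digraph_axioms_def wf_digraph_def)
  let ?f = "\<lambda>a. A d (x (tail G a)) (L a)"
  have "(\<Sum>u \<in> verts G. \<Sum>a \<in> in_arcs G u. ?f a) = (\<Sum>a \<in> arcs G. ?f a)"
    unfolding in_arcs_def using G(2,1,4) by (rule sum.group)
  also have "\<dots> = (\<Sum>u \<in> verts G. \<Sum>a \<in> out_arcs G u. ?f a)"
    unfolding out_arcs_def using G(2,1,3) by (rule sum.group[symmetric])
  also have "\<dots> = (\<Sum>u \<in> verts G. sent A d (x u))"
  proof (rule sum.cong[OF refl])
    fix u assume "u \<in> verts G"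
    then have "bij_betw L (out_arcs G u) {..<d}"
      using assms(2) by (simp add: edge_labeling_def)
    then show "(\<Sum>a \<in> out_arcs G u. ?f a) = sent A d (x u)"
      unfolding sent_def by (subst sum.reindex_bij_betw[symmetric]) (auto intro!: sum.cong)
  qed
  finally have "(\<Sum>u \<in> verts G. balance_step A d G L x u)
      = (\<Sum>u \<in> verts G. kept A d (x u) + sent A d (x u))"
    by (simp add: balance_step_def sum.distrib)
  \<comment> \<open>Validity makes the truncated subtraction in \<open>kept\<close> exact.\<close>
  also have "\<dots> = (\<Sum>u \<in> verts G. x u)"
    using assms(1) by (simp add: kept_def valid_alg_def)
  finally show ?thesis .
qed

lemma sum_load_at:
  assumes "valid_alg A" "edge_labeling G d L" and "fin_digraph G"
  shows "(\<Sum>u \<in> verts G. load_at A d G L x t u) = (\<Sum>u \<in> verts G. x u)"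
  by (induction t) (simp_all add: sum_balance_step[OF assms])

lemma discrepancy_ge:
  assumes "finite (verts G)" "u \<in> verts G" "v \<in> verts G"
  shows "x u - x v \<le> discrepancy G x"
proof -
  have "x u \<le> Max (x ` verts G)" "Min (x ` verts G) \<le> x v"
    using assms by simp_all
  then show ?thesis
    unfolding discrepancy_def by linarith
qed

text \<open>Discrepancy 0 forces a constant load, whose total is a multiple of the number of
  vertices.\<close>

lemma discrepancy_pos_if_not_dvd:
  assumes "finite (verts G)" "\<not> card (verts G) dvd (\<Sum>u \<in> verts G. x u)"
  shows "discrepancy G x > 0"
proof (rule ccontr)
  assume "\<not> discrepancy G x > 0"
  then have le: "x u \<le> x v" if "u \<in> verts G" "v \<in> verts G" for u v
    using discrepancy_ge[OF assms(1) that, of x] by simp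
  obtain v where v: "v \<in> verts G"
    using assms(2) by (cases "verts G = {}") auto
  have "(\<Sum>u \<in> verts G. x u) = (\<Sum>u \<in> verts G. x v)"
    using le v by (intro sum.cong refl antisym) auto
  then show False
    using assms(2) by simp
qed

section \<open>A stationary configuration\<close>

lemma valid_alg_zero:
  assumes "valid_alg A" "p < d"
  shows "A d 0 p = 0"
proof -
  have "sent A d 0 \<le> 0"
    using assms(1) unfolding valid_alg_def by blast
  then show ?thesis
    using assms(2) by (simp add: sent_def)
qed

text \<open>Each port in use at load \<open>h\<close> carries at least one of at most
  \<open>h\<close> tokens, so at most \<open>h\<close> ports are in use; \<open>\<pi>\<close> lists
  them among its first \<open>h\<close> values.\<close>

lemma ex_port_order:
  assumes "valid_alg A" "h \<le> d"
  obtains \<pi> where "bij_betw \<pi> {..<d} {..<d}" "\<And>q. h \<le> q \<Longrightarrow> q < d \<Longrightarrow> A d h (\<pi> q) = 0"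
proof -
  let ?P = "{p \<in> {..<d}. A d h p \<noteq> 0}"
  have "card ?P = (\<Sum>p \<in> ?P. 1)"
    by simp
  also have "\<dots> \<le> (\<Sum>p \<in> ?P. A d h p)"
    by (intro sum_mono) auto
  also have "\<dots> \<le> (\<Sum>p < d. A d h p)"
    by (intro sum_mono2) auto
  also have "\<dots> \<le> h"
    using assms(1) by (simp add: valid_alg_def sent_def)
  finally have "card ?P \<le> h" .
  \<comment> \<open>The used ports are padded to exactly \<open>h\<close>, so that positions below
    \<open>h\<close> correspond to \<open>P\<close>.\<close>
  then obtain P where P: "?P \<subseteq> P" "P \<subseteq> {..<d}" "card P = h"
    using exists_subset_between[of ?P h "{..<d}"] assms(2) by auto
  have fin: "finite P"
    using P(2) finite_subset by blast
  obtain f where f: "bij_betw f {..<h} P"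
    using finite_same_card_bij[OF finite_lessThan fin] P(3) by auto
  obtain g where g: "bij_betw g {h..<d} ({..<d} - P)"
    using finite_same_card_bij[of "{h..<d}" "{..<d} - P"] P fin by (auto simp: card_Diff_subset)
  define \<pi> where "\<pi> q = (if q < h then f q else g q)" for q
  have "bij_betw \<pi> {..<h} P"
    using f by (rule bij_betw_cong[THEN iffD1, rotated]) (simp add: \<pi>_def)
  moreover have \<pi>2: "bij_betw \<pi> {h..<d} ({..<d} - P)"
    using g by (rule bij_betw_cong[THEN iffD1, rotated]) (simp add: \<pi>_def)
  ultimately have "bij_betw \<pi> ({..<h} \<union> {h..<d}) (P \<union> ({..<d} - P))"
    by (rule bij_betw_combine) auto
  moreover have "{..<h} \<union> {h..<d} = {..<d}" "P \<union> ({..<d} - P) = {..<d}"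
    using assms(2) P(2) by auto
  ultimately have "bij_betw \<pi> {..<d} {..<d}"
    by simp
  moreover have "A d h (\<pi> q) = 0" if "h \<le> q" "q < d" for q
  proof -
    have "\<pi> q \<in> {..<d} - P"
      using bij_betwE[OF \<pi>2] that by auto
    then show ?thesis
      using P(1) by auto
  qed
  ultimately show thesis by (rule that)
qed

lemma ex_stationary_labeling:
  assumes A: "valid_alg A" and reg: "regular (circulant N T) d"
    and h: "h \<le> d"
    and clique: "\<And>u v. u \<le> h \<Longrightarrow> v \<le> h \<Longrightarrow> u \<noteq> v \<Longrightarrow> (u, v) \<in> arcs (circulant N T)"
  defines "x \<equiv> \<lambda>u. if u \<le> h then h else 0"
  obtains L where "edge_labeling (circulant N T) d L"
    and "balance_step A d (circulant N T) L x = x"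
proof -
  let ?G = "circulant N T"
  obtain \<pi> where \<pi>: "bij_betw \<pi> {..<d} {..<d}" "\<And>q. h \<le> q \<Longrightarrow> q < d \<Longrightarrow> A d h (\<pi> q) = 0"
    using ex_port_order[OF A h] by blast
  \<comment> \<open>Only the tail's own choice is constrained: clique arcs get ports by offset, arcs
    leaving the clique get idle ports. The bound \<open>p < d\<close> later makes
    \<open>valid_alg_zero\<close> applicable to tails of load 0.\<close>
  define Q where "Q a p \<longleftrightarrow> p < d \<and> (fst a \<le> h \<longrightarrow>
    (if snd a \<le> h then p = \<pi> (cyclic_offset h (fst a) (snd a)) else A d h p = 0))" for a p
  have "\<exists>f. bij_betw f (out_arcs ?G u) {..<d} \<and> (\<forall>a \<in> out_arcs ?G u. Q a (f a))"
    if u: "u \<in> verts ?G" for u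
  proof -
    have fin: "finite (out_arcs ?G u)"
      using finite_arcs_circulant by (simp add: out_arcs_def)
    have card: "card (out_arcs ?G u) = d"
      using reg u by (auto simp: regular_def out_degree_def)
    show ?thesis
    proof (cases "u \<le> h")
      case False
      obtain f where f: "bij_betw f (out_arcs ?G u) {..<d}"
        using finite_same_card_bij[OF fin finite_lessThan] card by auto
      then have "\<forall>a \<in> out_arcs ?G u. Q a (f a)"
        using False bij_betwE[OF f] by (auto simp: Q_def)
      then show ?thesis using f by blast
    next
      case True
      define C where "C = Pair u ` ({..h} - {u})"
      have C: "C \<subseteq> out_arcs ?G u"
        using clique True by (auto simp: C_def out_arcs_def)
      have "card C = h"
        using True by (simp add: C_def card_image inj_on_def)
      then have "card (out_arcs ?G u - C) = card {h..<d}"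
        using C card fin by (simp add: card_Diff_subset finite_subset)
      then obtain g where g: "bij_betw g (out_arcs ?G u - C) {h..<d}"
        using finite_same_card_bij[of "out_arcs ?G u - C" "{h..<d}"] fin by auto
      \<comment> \<open>\<open>r\<close> is the position of an arc in the order
        \<open>\<pi>\<close>: clique arcs come first, by offset, and the remaining arcs fill
        \<open>h\<close> to \<open>d - 1\<close>.\<close>
      define r where "r a = (if a \<in> C then cyclic_offset h u (snd a) else g a)" for a
      have "bij_betw snd C ({..h} - {u})"
        by (auto simp: C_def bij_betw_def inj_on_def image_image)
      then have "bij_betw (cyclic_offset h u \<circ> snd) C {..<h}"
        using bij_betw_cyclic_offset_head[OF True] by (rule bij_betw_trans)
      then have r1: "bij_betw r C {..<h}"
        by (rule bij_betw_cong[THEN iffD1, rotated]) (simp add: r_def)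
      have r2: "bij_betw r (out_arcs ?G u - C) {h..<d}"
        using g by (rule bij_betw_cong[THEN iffD1, rotated]) (simp add: r_def)
      have "bij_betw r (C \<union> (out_arcs ?G u - C)) ({..<h} \<union> {h..<d})"
        using r1 r2 by (rule bij_betw_combine) auto
      moreover have "C \<union> (out_arcs ?G u - C) = out_arcs ?G u" "{..<h} \<union> {h..<d} = {..<d}"
        using C h by auto
      ultimately have r: "bij_betw r (out_arcs ?G u) {..<d}"
        by simp
      then have bij: "bij_betw (\<pi> \<circ> r) (out_arcs ?G u) {..<d}"
        using \<pi>(1) by (rule bij_betw_trans)
      have "Q a ((\<pi> \<circ> r) a)" if a: "a \<in> out_arcs ?G u" for a
      proof (cases "a \<in> C")
        case True
        then have "(\<pi> \<circ> r) a = \<pi> (cyclic_offset h (fst a) (snd a))" "snd a \<le> h"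
          using a by (auto simp: r_def C_def)
        moreover have "(\<pi> \<circ> r) a < d"
          using bij_betwE[OF bij] a by blast
        ultimately show ?thesis
          by (simp add: Q_def)
      next
        case False
        then have "\<not> snd a \<le> h"
          using a by (cases a) (auto simp: C_def out_arcs_def)
        moreover have "r a \<in> {h..<d}"
          using bij_betwE[OF r2] False a by auto
        ultimately show ?thesis
          using bij_betwE[OF bij] a \<pi>(2) by (auto simp: Q_def)
      qed
      then show ?thesis using bij by blast
    qed
  qed
  then obtain L where L: "edge_labeling ?G d L"
    and Q: "\<And>a. a \<in> arcs ?G \<Longrightarrow> tail ?G a \<in> verts ?G \<Longrightarrow> Q a (L a)"
    using edge_labeling_choice[of ?G d Q] by blast
  have Q': "Q (w, u) (L (w, u))" if "(w, u) \<in> arcs ?G" for w u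
    using Q[OF that] that by simp
  have "balance_step A d ?G L x u = x u" for u
  proof -
    let ?f = "\<lambda>a. A d (x (fst a)) (L a)"
    have fin: "finite (in_arcs ?G u)"
      using finite_arcs_circulant by (simp add: in_arcs_def)
    \<comment> \<open>Such an arc has a tail of load 0 or leaves the clique through an idle
      port.\<close>
    have outside: "?f a = 0" if "a \<in> in_arcs ?G u" "\<not> (fst a \<le> h \<and> u \<le> h)" for a
      using that Q'[of "fst a" u] valid_alg_zero[OF A]
      by (cases a) (auto simp: in_arcs_def Q_def x_def split: if_splits)
    show ?thesis
    proof (cases "u \<le> h")
      case False
      then have "(\<Sum>a \<in> in_arcs ?G u. ?f a) = 0"
        using outside by (intro sum.neutral) auto
      then show ?thesis
        using False by (simp add: balance_step_def x_def kept_def)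
    next
      case True
      define C where "C = (\<lambda>w. (w, u)) ` ({..h} - {u})"
      have C: "C \<subseteq> in_arcs ?G u"
        using clique True by (auto simp: C_def in_arcs_def)
      have "(\<Sum>a \<in> in_arcs ?G u. ?f a) = (\<Sum>a \<in> C. ?f a)"
      proof (rule sum.mono_neutral_right[OF fin C], rule ballI)
        fix a assume "a \<in> in_arcs ?G u - C"
        then show "?f a = 0"
          by (intro outside) (cases a, auto simp: C_def in_arcs_def)+
      qed
      also have "\<dots> = (\<Sum>w \<in> {..h} - {u}. A d (x w) (L (w, u)))"
        unfolding C_def by (subst sum.reindex) (auto simp: inj_on_def)
      also have "\<dots> = (\<Sum>w \<in> {..h} - {u}. A d h (\<pi> (cyclic_offset h w u)))"
        using Q' clique True by (intro sum.cong refl) (auto simp: x_def Q_def simp del: circulant_simps)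
      also have "\<dots> = (\<Sum>q<h. A d h (\<pi> q))"
        by (rule sum.reindex_bij_betw[OF bij_betw_cyclic_offset_tail[OF True]])
      \<comment> \<open>Positions from \<open>h\<close> on are idle, so the first \<open>h\<close>
        account for everything a clique vertex sends.\<close>
      also have "\<dots> = (\<Sum>q<d. A d h (\<pi> q))"
        using \<pi>(2) h by (intro sum.mono_neutral_left) auto
      also have "\<dots> = sent A d h"
        unfolding sent_def by (rule sum.reindex_bij_betw[OF \<pi>(1)])
      finally show ?thesis
        using A True by (simp add: balance_step_def x_def kept_def valid_alg_def)
    qed
  qed
  then show thesis
    using that L by blast
qed

lemma load_at_stationary:
  assumes "balance_step A d G L x = x"
  shows "load_at A d G L x t = x"
  by (induction t) (simp_all add: assms)

theorem theorem4:
  shows "\<exists>c::real. c > 0 \<and>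
    (\<forall>A. valid_alg A \<longrightarrow>
      (\<forall>n d. even n \<and> d < n \<longrightarrow>
        (\<exists>(G :: (nat, nat \<times> nat) pre_digraph) L x\<^sub>0.
           graph G \<and> card (verts G) = n \<and> regular G d \<and> edge_labeling G d L \<and>
           (\<forall>t. real (discrepancy G (load_at A d G L x\<^sub>0 t)) \<ge> c * real d))))"
proof (intro exI[of _ "1/3"] conjI allI impI)
  fix A n d
  assume A: "valid_alg A" and nd: "even n \<and> d < (n::nat)"
  define N where "N = n - 1"
  have N: "odd N" "d \<le> N" "n = Suc N"
    using nd by (auto simp: N_def)
  define G where "G = circulant N (band_offsets N d)"
  have graph: "graph G"
    unfolding G_def using band_offsets_sym[OF N(1,2)] by (rule graph_circulant)
  have reg: "regular G d"
    using regular_circulant[OF band_offsets_subset[OF N(1,2)]] card_band_offsets[OF N(1,2)]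
    by (simp add: G_def)
  have verts: "verts G = {..N}"
    by (simp add: G_def)
  have fin: "fin_digraph G"
    using graph by (simp add: graph_def digraph_def)
  have "\<exists>L x. edge_labeling G d L \<and>
    (\<forall>t. real (discrepancy G (load_at A d G L x t)) \<ge> 1/3 * real d)"
  \<comment> \<open>For \<open>d = 1\<close> the clique load \<open>d div 2\<close> would be 0. The
    degenerate case \<open>d = 0\<close> stays in the second branch, where the bound is
    trivial.\<close>
  proof (cases "d = 1")
    case True
    obtain L where L: "edge_labeling G d L"
      using regular_imp_ex_edge_labeling[OF finite_arcs_circulant reg[unfolded G_def]]
      unfolding G_def .
    define x :: "nat \<Rightarrow> nat" where "x u = (if u = 0 then 1 else 0)" for u
    have "discrepancy G (load_at A d G L x t) > 0" for t
    proof (rule discrepancy_pos_if_not_dvd)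
      have "(\<Sum>u \<in> verts G. load_at A d G L x t u) = 1"
        unfolding sum_load_at[OF A L fin] by (simp add: x_def verts)
      then show "\<not> card (verts G) dvd (\<Sum>u \<in> verts G. load_at A d G L x t u)"
        using odd_pos[OF N(1)] by (simp add: verts)
    qed (simp add: verts)
    then have "real (discrepancy G (load_at A d G L x t)) \<ge> 1" for t
      by (simp add: Suc_le_eq)
    then have "real (discrepancy G (load_at A d G L x t)) \<ge> 1/3 * real d" for t
      by (rule order_trans[rotated]) (simp add: True)
    then show ?thesis
      using L by blast
  next
    case False
    define h where "h = d div 2"
    \<comment> \<open>\<open>h < N\<close> places vertex \<open>N\<close> outside the clique, as the
      witness for load 0.\<close>
    have h: "h \<le> d" "h < N"
      using N(1,2) odd_pos[OF N(1)] unfolding h_def by linarith+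
    define x where "x = (\<lambda>u. if u \<le> h then h else 0)"
    have clique: "(u, v) \<in> arcs (circulant N (band_offsets N d))"
      if "u \<le> h" "v \<le> h" "u \<noteq> v" for u v
      using clique_circulant_band[OF N(2)] that unfolding h_def .
    obtain L where L: "edge_labeling G d L" "balance_step A d G L x = x"
      using ex_stationary_labeling[OF A reg[unfolded G_def] h(1) clique]
      unfolding G_def x_def .
    have "h \<le> discrepancy G x"
      using discrepancy_ge[of G 0 N x] h by (simp add: verts x_def)
    \<comment> \<open>Source of the constant \<open>1/3\<close>: the inequality is tight at
      \<open>d = 3\<close>, where \<open>h = 1\<close>.\<close>
    moreover have "d \<le> 3 * h"
      using False unfolding h_def by linarith
    then have "1/3 * real d \<le> real h"
      by (simp flip: of_nat_le_iff[where 'a = real])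
    ultimately have "real (discrepancy G (load_at A d G L x t)) \<ge> 1/3 * real d" for t
      by (simp add: load_at_stationary[OF L(2)])
    then show ?thesis
      using L(1) by blast
  qed
  then show "\<exists>(G :: (nat, nat \<times> nat) pre_digraph) L x\<^sub>0.
      graph G \<and> card (verts G) = n \<and> regular G d \<and> edge_labeling G d L \<and>
      (\<forall>t. real (discrepancy G (load_at A d G L x\<^sub>0 t)) \<ge> 1/3 * real d)"
    using graph reg verts N(3) by (intro exI[of _ G]) simp
qed simp

end
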